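(* For every pair of integers $a,b\geq 1$, the looped graph $G_{a,b}$ (defined in the context) is connected and $$x\mid q(G_{a,b};x,y)\quad\text{in }\mathbb{Z}[x,y].$$ In particular, $q(G_{a,b};x,y)$ is reducible in $\mathbb{Z}[x,y]$.
   Context: For a finite graph $G$ without multiple edges (loops allowed), the adjacency matrix $\mathcal{A}(G)=(a_{ij})$ over $\mathbb{F}_2$ is the symmetric matrix whose diagonal entry $a_{ii}$ is $1$ if and only if vertex $i$ is looped, and whose off-diagonal entry $a_{ij}$ is $1$ if and only if $i$ and $j$ are joined by an edge. For $S\subseteq V(G)$, $G[S]$ is the induced subgraph on $S$ (loops at vertices of $S$ are kept), and $r(G[S])$ and $n(G[S])=|S|-r(G[S])$ denote the rank and nullity over $\mathbb{F}_2$ of $\mathcal{A}(G[S])$ (both are $0$ for $S=\varnothing$). The two-variable interlace polynomial is $$q(G;x,y)=\sum_{S\subseteq V(G)}(x-1)^{r(G[S])}(y-1)^{n(G[S])}.$$ Let $a,b\geq 1$ be integers, and let $X=\{x_1,\ldots,x_a\}$, $Y=\{y_1,\ldots,y_b\}$ and $\{u,v,w\}$ be three pairwise disjoint sets (with $a$, $b$, $3$ elements respectively). The graph $G_{a,b}$ has vertex set $X\sqcup Y\sqcup\{u,v,w\}$; its looped vertices are exactly the vertices in $X\cup Y$ (so $u,v,w$ are unlooped); and its non-loop edges are exactly $$\{x_iy_j:1\leq i\leq a,\ 1\leq j\leq b\}\cup\{x_iw:1\leq i\leq a\}\cup\{y_ju:1\leq j\leq b\}\cup\{uv,vw\}.$$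 Here $x_i,y_j,u,v,w$ are vertex names, unrelated to the polynomial variables $x,y$. *)

theory Defs
  imports
    "HOL-Library.Z2"
    "HOL-Computational_Algebra.Polynomial"
    "Jordan_Normal_Form.DL_Rank"
    "Graph_Theory.Graph_Theory"
begin

section \<open>Looped graphs and their adjacency matrices\<close>

text \<open>
  A finite graph with loops allowed and without multiple edges is a finite symmetric digraph
  without parallel arcs (locale \<open>pair_pseudo_graph\<close>): the edge joining two distinct
  vertices \<open>s\<close>, \<open>t\<close> is the pair of arcs \<open>(s, t)\<close>, \<open>(t, s)\<close>,
  and a loop at \<open>s\<close> is the single arc \<open>(s, s)\<close>.
  The induced subgraph on \<open>S\<close> is \<open>G \<restriction> S\<close>, which keeps the loops at vertices of
  \<open>S\<close>. The field with two elements is the type \<^typ>\<open>bit\<close>.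
\<close>

definition adjacency_matrix :: "('v, 'e) pre_digraph \<Rightarrow> 'v list \<Rightarrow> bit mat" where
  "adjacency_matrix G vs =
     mat (length vs) (length vs) (\<lambda>(i, j). if (vs ! i, vs ! j) \<in> arcs_ends G then 1 else 0)"

abbreviation bit_rank :: "bit mat \<Rightarrow> nat" where
  "bit_rank A \<equiv> vec_space.rank (dim_row A) A"

text \<open>
  The rank does not depend on the enumeration of the vertices chosen here; see
  \<open>graph_rank_eq\<close> below.
\<close>

definition graph_rank :: "('v, 'e) pre_digraph \<Rightarrow> nat" where
  "graph_rank G =
     bit_rank (adjacency_matrix G (SOME vs. distinct vs \<and> set vs = verts G))"

definition graph_nullity :: "('v, 'e) pre_digraph \<Rightarrow> nat" where
  "graph_nullity G = card (verts G) - graph_rank G"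

lemma (in vec_space) lin_indpt_permute_coords:
  assumes p: "p permutes {..<n}" and U: "U \<subseteq> carrier_vec n" and indpt: "lin_indpt U"
  shows "lin_indpt ((\<lambda>v. vec n (\<lambda>i. v $ p i)) ` U)"
proof
  let ?f = "\<lambda>v. vec n (\<lambda>i. v $ p i)"
  assume "lin_dep (?f ` U)"
  then obtain A c v where A: "finite A" "A \<subseteq> ?f ` U" "lincomb c A = 0\<^sub>v n" "v \<in> A" "c v \<noteq> 0"
    unfolding lin_dep_def by blast
  obtain B where B: "B \<subseteq> U" "inj_on ?f B" "A = ?f ` B"
    using A(2) unfolding subset_image_inj by blast
  have finB: "finite B" using A(1) B by (simp add: finite_image_iff)
  have cB: "B \<subseteq> carrier_vec n" and cA: "A \<subseteq> carrier_vec n" using B U by auto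
  have "lincomb (\<lambda>x. c (?f x)) B = 0\<^sub>v n"
  proof (rule eq_vecI)
    show "dim_vec (lincomb (\<lambda>x. c (?f x)) B) = dim_vec (0\<^sub>v n)"
      using lincomb_dim[OF finB cB] by simp
    fix j assume "j < dim_vec (0\<^sub>v n)"
    then have j: "j < n" by simp
    define i where "i = inv_into UNIV p j"
    have pi: "p i = j" using p by (simp add: i_def permutes_inverses)
    have i: "i < n" using p j pi by (metis lessThan_iff permutes_in_image)
    have "0 = lincomb c A $ i" using A(3) i by simp
    also have "\<dots> = (\<Sum>x\<in>A. c x * x $ i)" by (rule lincomb_index[OF i cA])
    also have "\<dots> = (\<Sum>x\<in>B. c (?f x) * x $ j)"
      using i pi by (simp add: B(3) sum.reindex[OF B(2)])
    also have "\<dots> = lincomb (\<lambda>x. c (?f x)) B $ j" by (rule lincomb_index[OF j cB, symmetric])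
    finally show "lincomb (\<lambda>x. c (?f x)) B $ j = 0\<^sub>v n $ j" using j by simp
  qed
  moreover obtain u where "u \<in> B" "c (?f u) \<noteq> 0" using A(4,5) B(3) by auto
  ultimately have "\<exists>C e u. finite C \<and> C \<subseteq> U \<and> True \<and> lincomb e C = 0\<^sub>v n \<and> u \<in> C \<and> e u \<noteq> 0"
    using finB B(1) by (intro exI[of _ B] exI[of _ "\<lambda>x. c (?f x)"] exI[of _ u]) simp
  then have "lin_dep U" unfolding lin_dep_def by simp
  then show False using indpt by simp
qed

lemma bit_rank_adjacency_matrix_le:
  assumes vs: "distinct vs" and ws: "distinct ws" and eq: "set vs = set ws"
  shows "bit_rank (adjacency_matrix G vs) \<le> bit_rank (adjacency_matrix G ws)"
proof -
  define n where "n = length vs"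
  have n: "n = length ws" using assms by (metis distinct_card n_def)
  interpret vec_space "TYPE(bit)" n .
  let ?A = "adjacency_matrix G vs" and ?B = "adjacency_matrix G ws"
  have cA: "?A \<in> carrier_mat n n" and cB: "?B \<in> carrier_mat n n"
    by (simp_all add: adjacency_matrix_def n_def[symmetric] n[symmetric])
  have "mset ws = mset vs" using assms by (simp add: set_eq_iff_mset_eq_distinct)
  then obtain p where p: "p permutes {..<length vs}" "permute_list p vs = ws"
    using mset_eq_permutation by metis
  have pn: "p permutes {..<n}" using p n_def by simp
  have wsi: "ws ! i = vs ! p i" if "i < n" for i
    using p that permute_list_nth n_def by blast
  have plt: "p i < n" if "i < n" for i using pn that by (metis lessThan_iff permutes_in_image)
  let ?f = "\<lambda>v. vec n (\<lambda>i. v $ p i)"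
  have cols_le: "?f ` set (cols ?A) \<subseteq> set (cols ?B)"
  proof
    fix y assume "y \<in> ?f ` set (cols ?A)"
    then obtain j where j: "j < n" "y = ?f (col ?A j)" using cA by (auto simp: cols_def)
    define k where "k = inv_into UNIV p j"
    have k: "p k = j" using pn by (simp add: k_def permutes_inverses)
    have kn: "k < n" using pn j k by (metis lessThan_iff permutes_in_image)
    have "y = col ?B k"
      using j kn k plt by (intro eq_vecI)
        (auto simp: adjacency_matrix_def n_def[symmetric] n[symmetric] wsi)
    then show "y \<in> set (cols ?B)" using kn cB by (auto simp: cols_def)
  qed
  have indpt0: "lin_indpt {}" unfolding lin_dep_def by blast
  have "\<exists>S. finite S \<and> maximal S (\<lambda>T. T \<subseteq> set (cols ?A) \<and> lin_indpt T) \<and> {} \<subseteq> S"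
    by (rule maximal_exists_superset[of "set (cols ?A)"]) (use indpt0 in blast)+
  then obtain S where S: "maximal S (\<lambda>T. T \<subseteq> set (cols ?A) \<and> lin_indpt T)" by blast
  then have SA: "S \<subseteq> set (cols ?A)" "lin_indpt S" by (auto simp: maximal_def)
  have Sc: "S \<subseteq> carrier_vec n" using SA(1) cols_dim[of ?A] cA by auto
  have inj: "inj_on ?f S"
  proof (rule inj_onI, rule eq_vecI)
    fix v w i assume vw: "v \<in> S" "w \<in> S" and e: "?f v = ?f w"
    have dim: "dim_vec v = n" "dim_vec w = n"
      using vw Sc by (blast dest: carrier_vecD subsetD)+
    show "dim_vec v = dim_vec w" by (simp only: dim)
    assume "i < dim_vec w"
    then have "i < n" by (simp only: dim)
    then have "inv_into UNIV p i < n" by (metis lessThan_iff permutes_in_image permutes_inv pn)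
    then have "?f v $ inv_into UNIV p i = v $ i" "?f w $ inv_into UNIV p i = w $ i"
      using pn by (simp_all add: permutes_inverses)
    then show "v $ i = w $ i" using e by simp
  qed
  have "rank ?A = card S" by (rule rank_card_indpt[OF cA S])
  also have "\<dots> = card (?f ` S)" using inj by (simp add: card_image)
  also have "\<dots> \<le> rank ?B"
    using cols_le SA(1) by (intro rank_ge_card_indpt[OF cB] lin_indpt_permute_coords pn Sc SA) auto
  finally show ?thesis using cA cB by simp
qed

lemma graph_rank_eq:
  assumes "distinct vs" "set vs = verts G"
  shows "graph_rank G = bit_rank (adjacency_matrix G vs)"
proof -
  let ?ws = "SOME vs. distinct vs \<and> set vs = verts G"
  have "distinct ?ws \<and> set ?ws = verts G"
    by (rule someI[of "\<lambda>vs. distinct vs \<and> set vs = verts G" vs]) (use assms in blast)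
  then have ws: "distinct ?ws" "set ?ws = verts G" by blast+
  have eq: "set ?ws = set vs" by (rule trans[OF ws(2) assms(2)[symmetric]])
  show ?thesis
    unfolding graph_rank_def
    by (rule antisym[OF bit_rank_adjacency_matrix_le[OF ws(1) assms(1) eq]
          bit_rank_adjacency_matrix_le[OF assms(1) ws(1) eq[symmetric]]])
qed

lemma graph_rank_le_card:
  assumes "finite (verts G)"
  shows "graph_rank G \<le> card (verts G)"
proof -
  obtain vs where vs: "distinct vs" "set vs = verts G"
    using finite_distinct_list[OF assms] by blast
  have "adjacency_matrix G vs \<in> carrier_mat (length vs) (length vs)"
    by (simp add: adjacency_matrix_def)
  from vec_space.rank_le_nc[OF this]
  have "bit_rank (adjacency_matrix G vs) \<le> length vs" by (simp add: adjacency_matrix_def)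
  then show ?thesis
    unfolding graph_rank_eq[OF vs] using distinct_card[OF vs(1)] by (simp only: vs(2))
qed


section \<open>The two-variable interlace polynomial\<close>

text \<open>
  The ring of integer polynomials in the two variables \<open>x\<close> and \<open>y\<close> is
  \<^typ>\<open>int poly poly\<close>: the outer variable is \<open>x\<close>, and the coefficients are
  polynomials in \<open>y\<close>.
\<close>

definition var_x :: "int poly poly" where "var_x = [:0, 1:]"

definition var_y :: "int poly poly" where "var_y = [:[:0, 1:]:]"

definition interlace_poly :: "('v, 'e) pre_digraph \<Rightarrow> int poly poly" where
  "interlace_poly G =
     (\<Sum>S\<in>Pow (verts G). (var_x - 1) ^ graph_rank (G \<restriction> S) * (var_y - 1) ^ graph_nullity (G \<restriction> S))"

definition reducible :: "'r::comm_ring_1 \<Rightarrow> bool" where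
  "reducible p \<longleftrightarrow> p \<noteq> 0 \<and> (\<exists>f g. p = f * g \<and> \<not> f dvd 1 \<and> \<not> g dvd 1)"


section \<open>The graphs \<open>G\<^bsub>a,b\<^esub>\<close>\<close>

datatype vertex = VX nat | VY nat | VU | VV | VW

definition Gab_edges :: "nat \<Rightarrow> nat \<Rightarrow> vertex rel" where
  "Gab_edges a b =
     {(VX i, VY j) | i j. i \<in> {1..a} \<and> j \<in> {1..b}} \<union> {(VX i, VW) | i. i \<in> {1..a}} \<union>
     {(VY j, VU) | j. j \<in> {1..b}} \<union> {(VU, VV), (VV, VW)}"

definition Gab :: "nat \<Rightarrow> nat \<Rightarrow> vertex pair_pre_digraph" where
  "Gab a b =
     \<lparr> pverts = VX ` {1..a} \<union> VY ` {1..b} \<union> {VU, VV, VW},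
       parcs = Id_on (VX ` {1..a} \<union> VY ` {1..b}) \<union> Gab_edges a b \<union> (Gab_edges a b)\<inverse> \<rparr>"

lemma pair_pseudo_graph_Gab: "pair_pseudo_graph (Gab a b)"
proof unfold_locales
  have wf: "parcs (Gab a b) \<subseteq> pverts (Gab a b) \<times> pverts (Gab a b)"
    unfolding Gab_def Gab_edges_def by force
  show fin: "finite (pverts (Gab a b))" by (simp add: Gab_def)
  show "finite (parcs (Gab a b))"
    by (rule finite_subset[OF wf finite_cartesian_product[OF fin fin]])
  have "sym (parcs (Gab a b))" by (auto simp: Gab_def sym_def)
  then show "symmetric (Gab a b)" by (simp add: symmetric_def)
  fix e assume "e \<in> parcs (Gab a b)"
  then have "e \<in> pverts (Gab a b) \<times> pverts (Gab a b)" using wf by (rule rev_subsetD)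
  then show "fst e \<in> pverts (Gab a b)" "snd e \<in> pverts (Gab a b)"
    by (simp_all add: mem_Times_iff)
qed

end

theory Submission
  imports Defs "Jordan_Normal_Form.Matrix_Kernel"
begin

text \<open>
  Divisibility by \<open>x\<close> means that the interlace polynomial vanishes at \<open>x = 0\<close>. As
  \<open>r(G[S]) = |S| - n(G[S])\<close>, this holds as soon as the vertex sets admit an involution that
  preserves the nullity of the induced subgraph and changes the parity of the size
  (\<open>var_x_dvd_interlace_polyI\<close>).

  Such an involution comes from a symmetry of the five-cycle \<open>x, y, u, v, w\<close> with loops at
  \<open>x\<close> and \<open>y\<close>, the smallest graph of the family. The principal pivot of its adjacency matrix
  on the odd set \<open>{x, u, v}\<close> is the same matrix with \<open>y\<close> and \<open>w\<close> exchanged. As a pivot on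
  \<open>D\<close> carries the nullity of the set \<open>S\<close> to that of the symmetric difference of \<open>S\<close> and \<open>D\<close>,
  toggling \<open>x\<close>, \<open>u\<close>, \<open>v\<close> and then swapping \<open>y\<close> with \<open>w\<close> preserves the nullity
  (\<open>card_cycle_kernel_pivot\<close>).

  The general graph reduces to the five-cycle, since the nullity of \<open>G[S]\<close> depends on
  \<open>S \<inter> X\<close> and \<open>S \<inter> Y\<close> only through the parities of their sizes
  (\<open>card_even_neighbour_sets_Gab\<close>). The involution is then performed with one vertex of \<open>X\<close> and
  one vertex of \<open>Y\<close>. Nullities are compared by counting kernel vectors: over the field with
  two elements the kernel has \<open>2\<close> to the nullity many elements
  (\<open>card_even_neighbour_sets\<close>).

  Reducibility follows by evaluation at \<open>x = y = 2\<close>, where the polynomial equals \<open>2\<close> to the number of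
  vertices (\<open>reducible_interlace_polyI\<close>).
\<close>

section \<open>Counting kernels over a finite field\<close>

text \<open>
  Each vector of the span is a linear combination for exactly one choice of coefficients
  on \<open>S\<close>, so the span is counted by the functions from \<open>S\<close> to the field.
\<close>

lemma (in vec_space) card_span_lin_indpt:
  assumes "finite (UNIV :: 'a set)" and S: "finite S" "S \<subseteq> carrier_vec n" "lin_indpt S"
  shows "card (span S) = card (UNIV :: 'a set) ^ card S"
proof -
  let ?comb = "\<lambda>c. lincomb c S" and ?coeffs = "S \<rightarrow>\<^sub>E (UNIV :: 'a set)"
  have "inj_on ?comb ?coeffs"
  proof (rule inj_onI)
    fix c d assume cd: "c \<in> ?coeffs" "d \<in> ?coeffs" and eq: "lincomb c S = lincomb d S"
    have "lincomb (\<lambda>v. c v - d v) S = 0\<^sub>v n"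
    proof (rule eq_vecI)
      fix i assume "i < dim_vec (0\<^sub>v n :: 'a vec)"
      then have i: "i < n" by simp
      have "lincomb (\<lambda>v. c v - d v) S $ i = lincomb c S $ i - lincomb d S $ i"
        by (simp add: lincomb_index[OF i S(2)] left_diff_distrib sum_subtractf)
      then show "lincomb (\<lambda>v. c v - d v) S $ i = 0\<^sub>v n $ i" using eq i by simp
    qed (simp add: lincomb_dim[OF S(1,2)])
    then have "(\<lambda>v. c v - d v) \<in> S \<rightarrow> {0}"
      using not_lindepD[OF S(3,1) order_refl, of "\<lambda>v. c v - d v"] by simp
    then have "c v = d v" if "v \<in> S" for v using that by auto
    then show "c = d" using cd by (intro PiE_ext)
  qed
  moreover have "span S = ?comb ` ?coeffs"
  proof
    show "span S \<subseteq> ?comb ` ?coeffs"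
    proof
      fix v assume "v \<in> span S"
      then obtain c where c: "v = lincomb c S" using finite_in_span[OF S(1)] S(2) by force
      have "v = lincomb (restrict c S) S"
        unfolding c by (rule lincomb_cong) (use S in auto)
      then show "v \<in> ?comb ` ?coeffs" by auto
    qed
    show "?comb ` ?coeffs \<subseteq> span S" using S(1) by auto
  qed
  ultimately show ?thesis by (simp add: card_image card_funcsetE S(1))
qed

text \<open>
  Rank-nullity over a finite field, in counting form: \<open>v \<mapsto> A v\<close> maps the whole space onto
  the column space, and its fibres are translates of the kernel. Counting turns equality of
  nullities into the existence of a bijection between kernels, so no basis of a kernel is
  ever needed.
\<close>

lemma (in vec_space) card_mat_kernel:
  assumes fin: "finite (UNIV :: 'a set)" and A: "A \<in> carrier_mat n nc"
  shows "card (UNIV :: 'a set) ^ rank A * card (mat_kernel A) = card (UNIV :: 'a set) ^ nc"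
proof -
  let ?f = "\<lambda>v. A *\<^sub>v v" and ?V = "carrier_vec nc :: 'a vec set"
  interpret src: vec_space "TYPE('a)" nc .
  have basis: "finite (set (unit_vecs nc) :: 'a vec set)" "src.basis (set (unit_vecs nc))"
    by (auto simp: src.unit_vecs_basis)
  have cardV: "card ?V = card (UNIV :: 'a set) ^ nc"
  proof -
    have "card (set (unit_vecs nc) :: 'a vec set) = nc"
      using distinct_card[OF src.unit_vecs_distinct] by (simp add: unit_vecs_def)
    then show ?thesis
      using src.card_span_lin_indpt[OF fin, of "set (unit_vecs nc)"] basis
      by (simp add: src.basis_def)
  qed
  have finV: "finite ?V"
    by (rule card_ge_0_finite) (use fin in \<open>simp add: cardV card_gt_0_iff\<close>)
  have indpt0: "lin_indpt {}" unfolding lin_dep_def by blast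
  \<comment> \<open>A maximal independent set of columns spans the column space and computes the rank.\<close>
  have "\<exists>S. finite S \<and> maximal S (\<lambda>T. T \<subseteq> set (cols A) \<and> lin_indpt T) \<and> {} \<subseteq> S"
    by (rule maximal_exists_superset[of "set (cols A)"]) (use indpt0 in blast)+
  then obtain S where S: "finite S" "maximal S (\<lambda>T. T \<subseteq> set (cols A) \<and> lin_indpt T)" by blast
  then have SA: "S \<subseteq> set (cols A)" "lin_indpt S" by (auto simp: maximal_def)
  have cols: "set (cols A) \<subseteq> carrier_vec n" using A cols_dim[of A] by auto
  have "set (cols A) \<subseteq> span S"
  proof
    fix c assume c: "c \<in> set (cols A)"
    show "c \<in> span S"
    proof (cases "c \<in> S")
      case True
      then show ?thesis using SA cols by (meson span_mem subset_trans)
    next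
      case False
      then have "\<not> lin_indpt (S \<union> {c})" using S(2) c SA(1) by (auto simp: maximal_def)
      then show ?thesis using lin_dep_iff_in_span[of S c] SA cols c False by auto
    qed
  qed
  then have "span (set (cols A)) = span S"
    using SA cols by (meson span_is_monotone span_subsetI subset_antisym subset_trans)
  moreover have "span (set (cols A)) = ?f ` ?V"
    using A unfolding col_space_eq[OF A, unfolded col_space_def] by auto
  ultimately have "card (?f ` ?V) = card (UNIV :: 'a set) ^ rank A"
    using card_span_lin_indpt[OF fin S(1) _ SA(2)] SA cols rank_card_indpt[OF A S(2)] by auto
  moreover have "card {v \<in> ?V. ?f v = w} = card (mat_kernel A)" if w: "w \<in> ?f ` ?V" for w
  proof -
    obtain u where u: "u \<in> ?V" "w = ?f u" using w by auto
    have "bij_betw (\<lambda>v. v + u) (mat_kernel A) {v \<in> ?V. ?f v = w}"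
    proof (rule bij_betw_byWitness[of _ "\<lambda>v. v - u"])
      show "(\<lambda>v. v + u) ` mat_kernel A \<subseteq> {v \<in> ?V. ?f v = w}"
        using A u by (auto simp: mat_kernel[OF A] mult_add_distrib_mat_vec[OF A])
      show "(\<lambda>v. v - u) ` {v \<in> ?V. ?f v = w} \<subseteq> mat_kernel A"
        using A u by (auto simp: mat_kernel[OF A] mult_minus_distrib_mat_vec[OF A])
      show "\<forall>v\<in>mat_kernel A. v + u - u = v"
        using A u by (auto simp: mat_kernel[OF A])
      show "\<forall>v\<in>{v \<in> ?V. ?f v = w}. v - u + u = v"
        using A u by auto
    qed
    then show ?thesis by (simp add: bij_betw_same_card)
  qed
  ultimately have "card (UNIV :: 'a set) ^ rank A * card (mat_kernel A) =
      (\<Sum>w \<in> ?f ` ?V. card {v \<in> ?V. ?f v = w})"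
    by simp
  also have "\<dots> = card ?V"
    using sum.image_gen[OF finV, of "\<lambda>_. 1::nat" ?f] by simp
  finally show ?thesis by (simp add: cardV)
qed

section \<open>Nullity of a graph by counting vertex sets\<close>

text \<open>
  The kernel of the adjacency matrix over the field with two elements, each vector being
  replaced by its support.
\<close>

definition even_neighbour_sets :: "('v, 'e) pre_digraph \<Rightarrow> 'v set set" where
  "even_neighbour_sets G =
     {T. T \<subseteq> verts G \<and> (\<forall>s\<in>verts G. even (card {t \<in> T. (s, t) \<in> arcs_ends G}))}"

lemma card_even_neighbour_sets:
  assumes fin: "finite (verts G)"
  shows "2 ^ graph_rank G * card (even_neighbour_sets G) = 2 ^ card (verts G)"
proof -
  obtain vs where vs: "distinct vs" "set vs = verts G"
    using finite_distinct_list[OF fin] by blast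
  define n where "n = length vs"
  define A where "A = adjacency_matrix G vs"
  have A: "A \<in> carrier_mat n n" by (simp add: A_def adjacency_matrix_def n_def)
  have verts: "verts G = (\<lambda>i. vs ! i) ` {..<n}"
    by (auto simp: vs(2)[symmetric] set_conv_nth n_def)
  have inj: "inj_on (\<lambda>i. vs ! i) {..<n}" using vs(1) by (simp add: inj_on_nth n_def)
  define ind :: "'a set \<Rightarrow> bit vec" where "ind T = vec n (\<lambda>i. of_bool (vs ! i \<in> T))" for T
  have ker: "ind T \<in> mat_kernel A \<longleftrightarrow> (\<forall>s\<in>verts G. even (card {t \<in> T. (s, t) \<in> arcs_ends G}))"
    if T: "T \<subseteq> verts G" for T
  proof -
    have "(A *\<^sub>v ind T) $ i = of_nat (card {t \<in> T. (vs ! i, t) \<in> arcs_ends G})" if i: "i < n" for i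
    proof -
      have "(A *\<^sub>v ind T) $ i =
          (\<Sum>j<n. of_bool (vs ! j \<in> T \<and> (vs ! i, vs ! j) \<in> arcs_ends G))"
        using i A unfolding scalar_prod_def mult_mat_vec_def atLeast0LessThan
        by (auto simp: ind_def A_def adjacency_matrix_def n_def simp del: sum_of_bool_eq intro!: sum.cong)
      also have "\<dots> = (\<Sum>t\<in>verts G. of_bool (t \<in> T \<and> (vs ! i, t) \<in> arcs_ends G))"
        unfolding verts by (simp add: sum.reindex[OF inj])
      also have "\<dots> = of_nat (card {t \<in> T. (vs ! i, t) \<in> arcs_ends G})"
        using T fin by (simp add: sum_of_bool_eq Collect_conj_eq Int_absorb1 flip: Int_assoc)
      finally show ?thesis .
    qed
    moreover have "(of_nat k :: bit) = 0 \<longleftrightarrow> even k" for k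
      by (induction k) auto
    ultimately show ?thesis
      using A by (auto simp: mat_kernel[OF A] vec_eq_iff ind_def verts)
  qed
  have bits: "(UNIV :: bit set) = {0, 1}" by auto
  have "bij_betw ind (even_neighbour_sets G) (mat_kernel A)"
  proof (rule bij_betw_byWitness[of _ "\<lambda>v. {vs ! i | i. i < n \<and> v $ i = 1}"])
    show "\<forall>T\<in>even_neighbour_sets G. {vs ! i |i. i < n \<and> ind T $ i = 1} = T"
    proof
      fix T assume "T \<in> even_neighbour_sets G"
      then have "T \<subseteq> (\<lambda>i. vs ! i) ` {..<n}" by (simp add: even_neighbour_sets_def verts)
      then show "{vs ! i |i. i < n \<and> ind T $ i = 1} = T"
        by (auto simp: ind_def cong: conj_cong)
    qed
    have inv: "ind {vs ! i |i. i < n \<and> v $ i = 1} = v" if "v \<in> mat_kernel A" for v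
    proof (rule eq_vecI)
      fix i assume i: "i < dim_vec v"
      have "dim_vec v = n" using that A by (auto simp: mat_kernel[OF A])
      then show "ind {vs ! i |i. i < n \<and> v $ i = 1} $ i = v $ i"
        using i inj by (auto simp: ind_def inj_on_def)
    qed (use that A in \<open>auto simp: mat_kernel[OF A] ind_def\<close>)
    then show "\<forall>v\<in>mat_kernel A. ind {vs ! i |i. i < n \<and> v $ i = 1} = v" by blast
    show "ind ` even_neighbour_sets G \<subseteq> mat_kernel A"
      using ker by (auto simp: even_neighbour_sets_def)
    show "(\<lambda>v. {vs ! i |i. i < n \<and> v $ i = 1}) ` mat_kernel A \<subseteq> even_neighbour_sets G"
    proof (rule image_subsetI)
      fix v assume v: "v \<in> mat_kernel A"
      have "{vs ! i |i. i < n \<and> v $ i = 1} \<subseteq> verts G" by (auto simp: verts)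
      then show "{vs ! i |i. i < n \<and> v $ i = 1} \<in> even_neighbour_sets G"
        using ker[of "{vs ! i |i. i < n \<and> v $ i = 1}"] v inv[OF v]
        by (simp add: even_neighbour_sets_def)
    qed
  qed
  then have "card (even_neighbour_sets G) = card (mat_kernel A)" by (rule bij_betw_same_card)
  moreover have "finite (UNIV :: bit set)" "card (UNIV :: bit set) = 2" unfolding bits by simp_all
  moreover have "card (verts G) = n" using distinct_card[OF vs(1)] by (simp add: vs(2) n_def)
  ultimately show ?thesis
    using vec_space.card_mat_kernel[of A n n] A
    by (simp add: graph_rank_eq[OF vs] A_def[symmetric])
qed

lemma graph_nullity_eqI:
  assumes "finite (verts G)" "finite (verts H)"
    and "card (even_neighbour_sets G) = card (even_neighbour_sets H)"
  shows "graph_nullity G = graph_nullity H"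
proof -
  have card: "card (even_neighbour_sets F) = 2 ^ graph_nullity F" if F: "finite (verts F)"
    for F :: "('v, 'w) pre_digraph"
  proof -
    have "2 ^ graph_rank F * card (even_neighbour_sets F) = 2 ^ graph_rank F * 2 ^ graph_nullity F"
      using card_even_neighbour_sets[OF F] graph_rank_le_card[OF F]
      by (simp add: graph_nullity_def flip: power_add)
    then show ?thesis by simp
  qed
  show ?thesis using assms card[of G] card[of H] by simp
qed

section \<open>The interlace polynomial at special values\<close>

text \<open>
  At \<open>x = 0\<close> the summand of \<open>S\<close> is \<open>(-1)\<close> to the rank of \<open>G[S]\<close> times a power of
  \<open>y - 1\<close> that depends on the nullity only. As rank and nullity add up to \<open>|S|\<close>, an
  involution that preserves the nullity and changes the parity of \<open>|S|\<close> makes the summands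
  cancel in pairs.
\<close>

lemma var_x_dvd_interlace_polyI:
  assumes fin: "finite (verts G)"
    and closed: "\<And>S. S \<subseteq> verts G \<Longrightarrow> \<phi> S \<subseteq> verts G"
    and invol: "\<And>S. S \<subseteq> verts G \<Longrightarrow> \<phi> (\<phi> S) = S"
    and parity: "\<And>S. S \<subseteq> verts G \<Longrightarrow> even (card (\<phi> S)) \<longleftrightarrow> odd (card S)"
    and nullity: "\<And>S. S \<subseteq> verts G \<Longrightarrow> graph_nullity (G \<restriction> \<phi> S) = graph_nullity (G \<restriction> S)"
  shows "var_x dvd interlace_poly G"
proof -
  define h :: "'a set \<Rightarrow> int poly" where
    "h S = (- 1) ^ graph_rank (G \<restriction> S) * ([:0, 1:] - 1) ^ graph_nullity (G \<restriction> S)" for S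
  have rank: "graph_rank (G \<restriction> S) + graph_nullity (G \<restriction> S) = card S" if "S \<subseteq> verts G" for S
    using graph_rank_le_card[of "G \<restriction> S"] finite_subset[OF that fin]
    by (simp add: graph_nullity_def)
  have flip: "h (\<phi> S) = - h S" if S: "S \<subseteq> verts G" for S
  proof -
    have "even (graph_rank (G \<restriction> \<phi> S)) \<longleftrightarrow> odd (graph_rank (G \<restriction> S))"
      using rank[OF S] rank[OF closed[OF S]] parity[OF S] nullity[OF S] by (metis even_add)
    then show ?thesis
      by (cases "even (graph_rank (G \<restriction> S))") (simp_all add: h_def nullity[OF S])
  qed
  have "bij_betw \<phi> (Pow (verts G)) (Pow (verts G))"
    by (rule bij_betw_byWitness[of _ \<phi>]) (use invol closed in auto)
  then have "(\<Sum>S\<in>Pow (verts G). h S) = (\<Sum>S\<in>Pow (verts G). h (\<phi> S))"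
    by (rule sum.reindex_bij_betw[symmetric])
  also have "\<dots> = - (\<Sum>S\<in>Pow (verts G). h S)"
    using flip by (simp add: sum_negf)
  finally have "(\<Sum>S\<in>Pow (verts G). h S) = 0" by (simp only: eq_neg_iff_add_eq_0)
  moreover have "poly (interlace_poly G) 0 = (\<Sum>S\<in>Pow (verts G). h S)"
    by (simp add: interlace_poly_def h_def poly_sum var_x_def var_y_def)
  ultimately have "poly (interlace_poly G) 0 = 0" by simp
  then have "[:- 0, 1:] dvd interlace_poly G" by (simp only: poly_eq_0_iff_dvd)
  then show ?thesis by (simp add: var_x_def)
qed

text \<open>
  At \<open>x = y = 2\<close> every summand of the interlace polynomial is \<open>1\<close>, so its value there is the
  number \<open>2\<^sup>n\<close> of vertex sets, where \<open>n\<close> is the number of vertices. The factor \<open>x\<close> accounts for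
  only one of these \<open>n \<ge> 2\<close> factors \<open>2\<close>, hence the cofactor takes an even value and is not a unit.
\<close>

lemma reducible_interlace_polyI:
  assumes fin: "finite (verts G)" and card: "2 \<le> card (verts G)"
    and dvd: "var_x dvd interlace_poly G"
  shows "reducible (interlace_poly G)"
proof -
  let ?ev = "\<lambda>p :: int poly poly. poly (poly p 2) 2"
  have unit: "?ev p dvd 1" if "p dvd 1" for p
    using that by (metis dvd_def poly_1 poly_mult)
  have ev: "?ev (interlace_poly G) = 2 ^ card (verts G)"
    by (simp add: interlace_poly_def poly_sum var_x_def var_y_def card_Pow fin)
  obtain g where g: "interlace_poly G = var_x * g" using dvd by (rule dvdE)
  have "\<not> var_x dvd 1" using unit[of var_x] by (auto simp: var_x_def)
  moreover have "\<not> g dvd 1"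
  proof
    assume "g dvd 1"
    then have "?ev g dvd 1" by (rule unit)
    moreover have "2 * ?ev g = 2 ^ card (verts G)"
      using ev unfolding g by (simp add: var_x_def)
    ultimately have "(2::int) ^ card (verts G) dvd 2"
      by (metis mult_dvd_mono dvd_refl mult.right_neutral)
    moreover have "(2::int) ^ 2 dvd 2 ^ card (verts G)" using card by (rule le_imp_power_dvd)
    ultimately have "(2::int) ^ 2 dvd 2" by (rule dvd_trans[rotated])
    then show False by simp
  qed
  moreover have "interlace_poly G \<noteq> 0" using ev by auto
  ultimately show ?thesis unfolding reducible_def using g by blast
qed

section \<open>A pivot symmetry of the five-cycle\<close>

text \<open>
  Let \<open>A\<close> be the adjacency matrix of the five-cycle \<open>x, y, u, v, w\<close> with loops at \<open>x\<close> and
  \<open>y\<close>, which is the smallest of the graphs. The arguments tell which vertices belong to a set \<open>S\<close>.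
  The elements are the vectors \<open>z\<close> such that \<open>(A z)\<^sub>s = 0\<close> if \<open>s \<in> S\<close> and \<open>z\<^sub>s = 0\<close>
  otherwise; this is the kernel of the principal submatrix on \<open>S\<close>, extended by zeros. In this form
  it treats \<open>z\<close> and \<open>A z\<close> symmetrically, which is what a pivot needs.
\<close>

definition cycle_kernel ::
  "bool \<Rightarrow> bool \<Rightarrow> bool \<Rightarrow> bool \<Rightarrow> bool \<Rightarrow> (bool \<times> bool \<times> bool \<times> bool \<times> bool) set" where
  "cycle_kernel x y u v w = {(zx, zy, zu, zv, zw).
     (if x then zx = (zy \<noteq> zw) else \<not> zx) \<and> (if y then zy = (zx \<noteq> zu) else \<not> zy) \<and>
     (if u then zy = zv else \<not> zu) \<and> (if v then zu = zw else \<not> zv) \<and>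
     (if w then zx = zv else \<not> zw)}"

text \<open>
  The principal pivot of \<open>A\<close> on \<open>{x, u, v}\<close> exchanges \<open>z\<^sub>s\<close> and \<open>(A z)\<^sub>s\<close> for \<open>s\<close> in that
  set; on kernels this toggles the membership of \<open>x\<close>, \<open>u\<close> and \<open>v\<close> in \<open>S\<close>. The pivoted
  matrix is again \<open>A\<close> once the names of \<open>y\<close> and \<open>w\<close> are swapped. Both operations together form
  a bijection between the kernels of two sets, the second of which is described by the arguments
  on the left-hand side.
\<close>

lemma card_cycle_kernel_pivot:
  "card (cycle_kernel (\<not> x) w (\<not> u) (\<not> v) y) = card (cycle_kernel x y u v w)"
proof -
  define f :: "bool \<times> bool \<times> bool \<times> bool \<times> bool \<Rightarrow> bool \<times> bool \<times> bool \<times> bool \<times> bool"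
    where "f = (\<lambda>(zx, zy, zu, zv, zw). ((zx \<noteq> zy) \<noteq> zw, zw, zy \<noteq> zv, zu \<noteq> zw, zy))"
  \<comment> \<open>With the matrix \<open>A\<close> of the five-cycle, \<open>f z\<close> is
    \<open>((A z)\<^sub>x, z\<^sub>w, (A z)\<^sub>u, (A z)\<^sub>v, z\<^sub>y)\<close>.\<close>
  have inv: "f (f z) = z" for z
    by (cases z) (simp add: f_def, argo)
  have maps: "f z \<in> cycle_kernel (\<not> x) w (\<not> u) (\<not> v) y"
    if "z \<in> cycle_kernel x y u v w" for x y u v w z
    using that unfolding f_def cycle_kernel_def
    by (cases z) (simp only: mem_Collect_eq split, argo)
  have "bij_betw f (cycle_kernel x y u v w) (cycle_kernel (\<not> x) w (\<not> u) (\<not> v) y)"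
  proof (rule bij_betw_byWitness[of _ f])
    show "\<forall>z\<in>cycle_kernel x y u v w. f (f z) = z"
      "\<forall>z\<in>cycle_kernel (\<not> x) w (\<not> u) (\<not> v) y. f (f z) = z"
      by (simp_all add: inv)
    show "f ` cycle_kernel x y u v w \<subseteq> cycle_kernel (\<not> x) w (\<not> u) (\<not> v) y"
      by (rule image_subsetI) (rule maps)
    show "f ` cycle_kernel (\<not> x) w (\<not> u) (\<not> v) y \<subseteq> cycle_kernel x y u v w"
    proof (rule image_subsetI)
      fix z assume "z \<in> cycle_kernel (\<not> x) w (\<not> u) (\<not> v) y"
      from maps[OF this] show "f z \<in> cycle_kernel x y u v w" by simp
    qed
  qed
  then show ?thesis by (simp add: bij_betw_same_card)
qed

section \<open>Reduction of the graphs to the five-cycle\<close>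

lemma induced_even_neighbour_sets:
  "even_neighbour_sets (with_proj G \<restriction> S) =
     {T. T \<subseteq> S \<and> (\<forall>s\<in>S. even (card {t \<in> T. (s, t) \<in> parcs G}))}"
proof -
  have "{t \<in> T. (s, t) \<in> arcs_ends (with_proj G \<restriction> S)} = {t \<in> T. (s, t) \<in> parcs G}"
    if "T \<subseteq> S" "s \<in> S" for T s
    using that by (auto simp: arcs_ends_def arc_to_ends_def)
  then show ?thesis by (auto simp: even_neighbour_sets_def)
qed

lemma all_vertex:
  "(\<forall>s. P s) \<longleftrightarrow> (\<forall>i. P (VX i)) \<and> (\<forall>j. P (VY j)) \<and> P VU \<and> P VV \<and> P VW"
  by (metis vertex.exhaust)

text \<open>
  The kernel equation at each kind of vertex. The loops at \<open>X\<close> and \<open>Y\<close> are what isolates a single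
  coordinate on the left-hand side; apart from that, \<open>X\<close> and \<open>Y\<close> enter as sums over the whole class,
  which is what makes the reduction to the five-cycle possible.
\<close>

lemma even_card_neighbours_Gab:
  assumes T: "T \<subseteq> pverts (Gab a b)" and s: "s \<in> pverts (Gab a b)"
  shows "even (card {t \<in> T. (s, t) \<in> parcs (Gab a b)}) \<longleftrightarrow>
    (case s of
       VX i \<Rightarrow> (VX i \<in> T) = (odd (card (T \<inter> range VY)) \<noteq> (VW \<in> T))
     | VY j \<Rightarrow> (VY j \<in> T) = (odd (card (T \<inter> range VX)) \<noteq> (VU \<in> T))
     | VU \<Rightarrow> odd (card (T \<inter> range VY)) = (VV \<in> T)
     | VV \<Rightarrow> (VU \<in> T) = (VW \<in> T)
     | VW \<Rightarrow> odd (card (T \<inter> range VX)) = (VV \<in> T))"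
proof -
  have "finite (pverts (Gab a b))" by (simp add: Gab_def)
  then have fin: "finite T" using T by (rule rev_finite_subset)
  have single: "card (T \<inter> {t}) = of_bool (t \<in> T)" for t by simp
  show ?thesis
  proof (cases s)
    case (VX i)
    have "{t \<in> T. (VX i, t) \<in> parcs (Gab a b)} = T \<inter> {VX i} \<union> T \<inter> range VY \<union> T \<inter> {VW}"
      using T s VX by (auto simp: Gab_def Gab_edges_def)
    moreover have "card (T \<inter> {VX i} \<union> T \<inter> range VY \<union> T \<inter> {VW}) =
        of_bool (VX i \<in> T) + card (T \<inter> range VY) + of_bool (VW \<in> T)"
      using fin by (subst card_Un_disjoint, simp, simp, blast)+ (simp only: single)
    ultimately show ?thesis using VX by simp
  next
    case (VY j)
    have "{t \<in> T. (VY j, t) \<in> parcs (Gab a b)} = T \<inter> {VY j} \<union> T \<inter> range VX \<union> T \<inter> {VU}"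
      using T s VY by (auto simp: Gab_def Gab_edges_def)
    moreover have "card (T \<inter> {VY j} \<union> T \<inter> range VX \<union> T \<inter> {VU}) =
        of_bool (VY j \<in> T) + card (T \<inter> range VX) + of_bool (VU \<in> T)"
      using fin by (subst card_Un_disjoint, simp, simp, blast)+ (simp only: single)
    ultimately show ?thesis using VY by simp
  next
    case VU
    have "{t \<in> T. (VU, t) \<in> parcs (Gab a b)} = T \<inter> range VY \<union> T \<inter> {VV}"
      using T s VU by (auto simp: Gab_def Gab_edges_def)
    moreover have "card (T \<inter> range VY \<union> T \<inter> {VV}) = card (T \<inter> range VY) + of_bool (VV \<in> T)"
      using fin by (subst card_Un_disjoint, simp, simp, blast)+ (simp only: single)
    ultimately show ?thesis using VU by simp
  next
    case VV
    have "{t \<in> T. (VV, t) \<in> parcs (Gab a b)} = T \<inter> {VU} \<union> T \<inter> {VW}"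
      using T s VV by (auto simp: Gab_def Gab_edges_def)
    moreover have "card (T \<inter> {VU} \<union> T \<inter> {VW}) = of_bool (VU \<in> T) + of_bool (VW \<in> T)"
      using fin by (subst card_Un_disjoint, simp, simp, blast)+ (simp only: single)
    ultimately show ?thesis using VV by simp
  next
    case VW
    have "{t \<in> T. (VW, t) \<in> parcs (Gab a b)} = T \<inter> range VX \<union> T \<inter> {VV}"
      using T s VW by (auto simp: Gab_def Gab_edges_def)
    moreover have "card (T \<inter> range VX \<union> T \<inter> {VV}) = card (T \<inter> range VX) + of_bool (VV \<in> T)"
      using fin by (subst card_Un_disjoint, simp, simp, blast)+ (simp only: single)
    ultimately show ?thesis using VW by simp
  qed
qed

text \<open>
  In a kernel vector of \<open>G[S]\<close> all coordinates at the vertices of \<open>S \<inter> X\<close> agree, because such a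
  vertex sees, besides its own loop, only \<open>Y\<close> and \<open>w\<close>; likewise for \<open>S \<inter> Y\<close>. All other
  equations involve these coordinates through their sums over \<open>X\<close> and over \<open>Y\<close>. The sums can
  therefore serve as the two coordinates \<open>z\<^sub>x\<close> and \<open>z\<^sub>y\<close> of a kernel vector of the five-cycle, and
  \<open>S \<inter> X\<close> counts as the vertex \<open>x\<close> if its size is odd and as nothing if it is even.
\<close>

lemma card_even_neighbour_sets_Gab:
  assumes S: "S \<subseteq> pverts (Gab a b)"
  shows "card (even_neighbour_sets (with_proj (Gab a b) \<restriction> S)) =
    card (cycle_kernel (odd (card (S \<inter> range VX))) (odd (card (S \<inter> range VY)))
      (VU \<in> S) (VV \<in> S) (VW \<in> S))" (is "card ?K = card ?C")
proof -
  define f where "f T = (odd (card (T \<inter> range VX)), odd (card (T \<inter> range VY)),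
    VU \<in> T, VV \<in> T, VW \<in> T)" for T
  \<comment> \<open>\<open>g\<close> reads the common coordinate on \<open>X\<close> off the equation at a vertex of \<open>X\<close>: it is
    \<open>z\<^sub>y + z\<^sub>w\<close>. On \<open>Y\<close> it is \<open>z\<^sub>x + z\<^sub>u\<close>.\<close>
  define g where "g = (\<lambda>(zx :: bool, zy :: bool, zu, zv, zw).
    {t \<in> S. case t of VX i \<Rightarrow> zy \<noteq> zw | VY j \<Rightarrow> zx \<noteq> zu | VU \<Rightarrow> zu | VV \<Rightarrow> zv | VW \<Rightarrow> zw})"
  have K: "T \<in> ?K \<longleftrightarrow> T \<subseteq> S \<and>
      (\<forall>i. VX i \<in> S \<longrightarrow> (VX i \<in> T) = (odd (card (T \<inter> range VY)) \<noteq> (VW \<in> T))) \<and>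
      (\<forall>j. VY j \<in> S \<longrightarrow> (VY j \<in> T) = (odd (card (T \<inter> range VX)) \<noteq> (VU \<in> T))) \<and>
      (VU \<in> S \<longrightarrow> odd (card (T \<inter> range VY)) = (VV \<in> T)) \<and>
      (VV \<in> S \<longrightarrow> (VU \<in> T) = (VW \<in> T)) \<and>
      (VW \<in> S \<longrightarrow> odd (card (T \<inter> range VX)) = (VV \<in> T))" for T
  proof (cases "T \<subseteq> S")
    case True
    then have T: "T \<subseteq> pverts (Gab a b)" using S by blast
    have "even (card {t \<in> T. (s, t) \<in> parcs (Gab a b)}) \<longleftrightarrow>
      (case s of
         VX i \<Rightarrow> (VX i \<in> T) = (odd (card (T \<inter> range VY)) \<noteq> (VW \<in> T))
       | VY j \<Rightarrow> (VY j \<in> T) = (odd (card (T \<inter> range VX)) \<noteq> (VU \<in> T))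
       | VU \<Rightarrow> odd (card (T \<inter> range VY)) = (VV \<in> T)
       | VV \<Rightarrow> (VU \<in> T) = (VW \<in> T)
       | VW \<Rightarrow> odd (card (T \<inter> range VX)) = (VV \<in> T))" if "s \<in> S" for s
      by (rule even_card_neighbours_Gab[OF T]) (use that S in blast)
    then have "T \<in> ?K \<longleftrightarrow> (\<forall>s\<in>S. case s of
         VX i \<Rightarrow> (VX i \<in> T) = (odd (card (T \<inter> range VY)) \<noteq> (VW \<in> T))
       | VY j \<Rightarrow> (VY j \<in> T) = (odd (card (T \<inter> range VX)) \<noteq> (VU \<in> T))
       | VU \<Rightarrow> odd (card (T \<inter> range VY)) = (VV \<in> T)
       | VV \<Rightarrow> (VU \<in> T) = (VW \<in> T)
       | VW \<Rightarrow> odd (card (T \<inter> range VX)) = (VV \<in> T))"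
      using True unfolding induced_even_neighbour_sets by simp
    also have "\<dots> \<longleftrightarrow>
      (\<forall>i. VX i \<in> S \<longrightarrow> (VX i \<in> T) = (odd (card (T \<inter> range VY)) \<noteq> (VW \<in> T))) \<and>
      (\<forall>j. VY j \<in> S \<longrightarrow> (VY j \<in> T) = (odd (card (T \<inter> range VX)) \<noteq> (VU \<in> T))) \<and>
      (VU \<in> S \<longrightarrow> odd (card (T \<inter> range VY)) = (VV \<in> T)) \<and>
      (VV \<in> S \<longrightarrow> (VU \<in> T) = (VW \<in> T)) \<and>
      (VW \<in> S \<longrightarrow> odd (card (T \<inter> range VX)) = (VV \<in> T))"
      unfolding Ball_def all_vertex by simp
    finally show ?thesis using True by blast
  qed (simp add: induced_even_neighbour_sets)
  have g_mem: "VX i \<in> g (zx, zy, zu, zv, zw) \<longleftrightarrow> VX i \<in> S \<and> zy \<noteq> zw"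
    "VY j \<in> g (zx, zy, zu, zv, zw) \<longleftrightarrow> VY j \<in> S \<and> zx \<noteq> zu"
    "VU \<in> g (zx, zy, zu, zv, zw) \<longleftrightarrow> VU \<in> S \<and> zu"
    "VV \<in> g (zx, zy, zu, zv, zw) \<longleftrightarrow> VV \<in> S \<and> zv"
    "VW \<in> g (zx, zy, zu, zv, zw) \<longleftrightarrow> VW \<in> S \<and> zw" for i j zx zy zu zv zw
    by (auto simp: g_def)
  have gX: "g (zx, zy, zu, zv, zw) \<inter> range VX = (if zy \<noteq> zw then S \<inter> range VX else {})"
    and gY: "g (zx, zy, zu, zv, zw) \<inter> range VY = (if zx \<noteq> zu then S \<inter> range VY else {})"
    for zx zy zu zv zw by (auto simp: g_def)
  have oddX: "odd (card (g (zx, zy, zu, zv, zw) \<inter> range VX)) \<longleftrightarrow>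
      zy \<noteq> zw \<and> odd (card (S \<inter> range VX))"
    and oddY: "odd (card (g (zx, zy, zu, zv, zw) \<inter> range VY)) \<longleftrightarrow>
      zx \<noteq> zu \<and> odd (card (S \<inter> range VY))" for zx zy zu zv zw
    by (simp_all add: gX gY)
  have fg: "f (g z) = z" if "z \<in> ?C" for z
    using that unfolding f_def cycle_kernel_def
    by (cases z) (simp only: mem_Collect_eq split g_mem oddX oddY prod.inject, argo)
  have gf: "g (f T) = T" if T: "T \<in> ?K" for T
  proof -
    have "t \<in> g (f T) \<longleftrightarrow> t \<in> T" for t
      using T[unfolded K] by (cases t; simp only: f_def g_mem) blast+
    then show ?thesis by blast
  qed
  have "bij_betw f ?K ?C"
  proof (rule bij_betw_byWitness[of _ g])
    show "\<forall>z\<in>?C. f (g z) = z" using fg by blast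
    show "\<forall>T\<in>?K. g (f T) = T" using gf by blast
    show "f ` ?K \<subseteq> ?C"
    proof (rule image_subsetI)
      fix T assume T: "T \<in> ?K"
      have "odd (card (T \<inter> range VX)) \<longleftrightarrow>
          odd (card (T \<inter> range VY)) \<noteq> (VW \<in> T) \<and> odd (card (S \<inter> range VX))"
        "odd (card (T \<inter> range VY)) \<longleftrightarrow>
          odd (card (T \<inter> range VX)) \<noteq> (VU \<in> T) \<and> odd (card (S \<inter> range VY))"
        using oddX oddY gf[OF T] unfolding f_def by metis+
      moreover have "VU \<in> T \<longrightarrow> VU \<in> S" "VV \<in> T \<longrightarrow> VV \<in> S" "VW \<in> T \<longrightarrow> VW \<in> S"
        "VU \<in> S \<longrightarrow> odd (card (T \<inter> range VY)) = (VV \<in> T)"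
        "VV \<in> S \<longrightarrow> (VU \<in> T) = (VW \<in> T)"
        "VW \<in> S \<longrightarrow> odd (card (T \<inter> range VX)) = (VV \<in> T)"
        using T[unfolded K] by blast+
      ultimately show "f T \<in> ?C"
        unfolding f_def cycle_kernel_def mem_Collect_eq split by argo
    qed
    show "g ` ?C \<subseteq> ?K"
    proof (rule image_subsetI)
      fix z assume z: "z \<in> ?C"
      obtain zx zy zu zv zw where z': "z = (zx, zy, zu, zv, zw)" by (cases z)
      have eqs: "odd (card (g z \<inter> range VX)) = zx" "odd (card (g z \<inter> range VY)) = zy"
        "(VU \<in> g z) = zu" "(VV \<in> g z) = zv" "(VW \<in> g z) = zw"
        using fg[OF z] unfolding f_def z' prod.inject by blast+
      have "VU \<in> S \<longrightarrow> zy = zv" "VV \<in> S \<longrightarrow> zu = zw" "VW \<in> S \<longrightarrow> zx = zv"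
        using z unfolding z' cycle_kernel_def mem_Collect_eq split by argo+
      moreover have "VX i \<in> g z \<longleftrightarrow> VX i \<in> S \<and> zy \<noteq> zw"
        "VY j \<in> g z \<longleftrightarrow> VY j \<in> S \<and> zx \<noteq> zu" for i j
        unfolding z' by (rule g_mem)+
      moreover have "g z \<subseteq> S" by (auto simp: g_def z')
      ultimately show "g z \<in> ?K" unfolding K eqs by blast
    qed
  qed
  then show ?thesis by (rule bij_betw_same_card)
qed

section \<open>Connectedness, divisibility and reducibility\<close>

text \<open>The vertex \<open>v\<close> is a hub: it is joined to every other vertex by a path of length at most two.\<close>

lemma connected_Gab:
  "Digraph_Component.connected (with_proj (Gab a b))"
proof -
  let ?V = "pverts (Gab a b)" and ?E = "(parcs (Gab a b))\<^sup>s"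
  have step: "(s, t) \<in> rtrancl_on ?V ?E" if "(s, t) \<in> ?E" "s \<in> ?V" "t \<in> ?V" for s t
    using that by (meson rtrancl_on.intros)
  have sym: "(t, s) \<in> ?E" if "(s, t) \<in> ?E" for s t
    using that by (auto simp: symcl_def)
  have hub: "(s, VV) \<in> rtrancl_on ?V ?E \<and> (VV, s) \<in> rtrancl_on ?V ?E" if s: "s \<in> ?V" for s
  proof -
    have V: "VU \<in> ?V" "VV \<in> ?V" "VW \<in> ?V" by (auto simp: Gab_def)
    have UW: "(VU, VV) \<in> ?E" "(VW, VV) \<in> ?E"
      by (auto simp: Gab_def Gab_edges_def symcl_def)
    have two: "(s, VV) \<in> rtrancl_on ?V ?E \<and> (VV, s) \<in> rtrancl_on ?V ?E"
      if "(s, t) \<in> ?E" "(t, VV) \<in> ?E" "t \<in> ?V" for t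
      using that s V step sym by (meson rtrancl_on_trans)
    show ?thesis
    proof (cases s)
      case (VX i)
      then have "(s, VW) \<in> ?E" using s by (auto simp: Gab_def Gab_edges_def symcl_def)
      then show ?thesis using two UW V by blast
    next
      case (VY j)
      then have "(s, VU) \<in> ?E" using s by (auto simp: Gab_def Gab_edges_def symcl_def)
      then show ?thesis using two UW V by blast
    next
      case VV
      then show ?thesis using V by simp
    qed (use UW V step sym in blast)+
  qed
  have "(s, t) \<in> rtrancl_on ?V ?E" if "s \<in> ?V" "t \<in> ?V" for s t
    using hub that by (meson rtrancl_on_trans)
  moreover have "?V \<noteq> {}" by (simp add: Gab_def)
  ultimately show ?thesis unfolding connected_conv by simp
qed

lemma odd_card_sym_diff:
  assumes "finite A" "finite B"
  shows "odd (card (sym_diff A B)) \<longleftrightarrow> odd (card A) \<noteq> odd (card B)"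
proof -
  have "card (sym_diff A B) = card (A - B) + card (B - A)"
    using assms by (subst card_Un_disjoint) auto
  moreover have "card A = card (A - B) + card (A \<inter> B)" "card B = card (B - A) + card (A \<inter> B)"
    using assms card_Diff_subset_Int card_mono
    by (metis Int_commute card_Int_Diff add.commute)+
  ultimately show ?thesis by (simp only: even_add) argo
qed

theorem proposition3p3:
  fixes a b :: nat
  assumes "a \<ge> 1" and "b \<ge> 1"
  shows "Digraph_Component.connected (with_proj (Gab a b))
    \<and> var_x dvd interlace_poly (with_proj (Gab a b))
    \<and> reducible (interlace_poly (with_proj (Gab a b)))"
proof -
  let ?G = "with_proj (Gab a b)"
  have fin: "finite (verts ?G)" by (simp add: Gab_def)
  have mem: "VX 1 \<in> verts ?G" "VY 1 \<in> verts ?G" "VU \<in> verts ?G" "VV \<in> verts ?G" "VW \<in> verts ?G"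
    using assms by (auto simp: Gab_def)
  \<comment> \<open>On the data of the five-cycle, the pivot toggles \<open>x\<close>, \<open>u\<close>, \<open>v\<close> and swaps \<open>y\<close> with \<open>w\<close>. The swap
    changes something only if exactly one of the two is present, and then it toggles both.
    Here this is carried out with \<open>x\<^sub>1\<close> and \<open>y\<^sub>1\<close>. In either case three or five vertices are
    toggled, an odd number.\<close>
  define mixed where "mixed S \<longleftrightarrow> odd (card (S \<inter> range VY)) \<noteq> (VW \<in> S)" for S
  define D where "D S = {VX 1, VU, VV} \<union> (if mixed S then {VY 1, VW} else {})" for S
  define \<phi> where "\<phi> S = sym_diff S (D S)" for S
  have D_in: "D S \<subseteq> verts ?G" for S using mem by (auto simp: D_def)
  have D_X: "D S \<inter> range VX = {VX 1}"
    and D_Y: "D S \<inter> range VY = (if mixed S then {VY 1} else {})"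
    and D_odd: "odd (card (D S))" for S
    by (auto simp: D_def)
  have toggle: "odd (card (\<phi> S \<inter> R)) \<longleftrightarrow> odd (card (S \<inter> R)) \<noteq> odd (card (D S \<inter> R))"
    if S: "S \<subseteq> verts ?G" for S R
  proof -
    have "finite S" "finite (D S)" using S D_in[of S] fin by (auto intro: rev_finite_subset)
    then have "odd (card (sym_diff (S \<inter> R) (D S \<inter> R))) \<longleftrightarrow>
        odd (card (S \<inter> R)) \<noteq> odd (card (D S \<inter> R))"
      by (intro odd_card_sym_diff) auto
    moreover have "\<phi> S \<inter> R = sym_diff (S \<inter> R) (D S \<inter> R)" by (auto simp: \<phi>_def)
    ultimately show ?thesis by simp
  qed
  have closed: "\<phi> S \<subseteq> verts ?G" if "S \<subseteq> verts ?G" for S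
    using that D_in[of S] by (auto simp: \<phi>_def)
  have oddX: "odd (card (\<phi> S \<inter> range VX)) \<longleftrightarrow> \<not> odd (card (S \<inter> range VX))"
    if "S \<subseteq> verts ?G" for S
    using toggle[OF that, of "range VX"] by (simp add: D_X)
  have oddY: "odd (card (\<phi> S \<inter> range VY)) \<longleftrightarrow> VW \<in> S" if "S \<subseteq> verts ?G" for S
    using toggle[OF that, of "range VY"] by (auto simp: D_Y mixed_def)
  have U: "VU \<in> \<phi> S \<longleftrightarrow> VU \<notin> S" and V: "VV \<in> \<phi> S \<longleftrightarrow> VV \<notin> S"
    and W: "VW \<in> \<phi> S \<longleftrightarrow> odd (card (S \<inter> range VY))" for S
    by (auto simp: \<phi>_def D_def mixed_def)
  have "var_x dvd interlace_poly ?G"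
  proof (rule var_x_dvd_interlace_polyI[where \<phi> = \<phi>])
    fix S assume S: "S \<subseteq> verts ?G"
    show "\<phi> S \<subseteq> verts ?G" by (rule closed[OF S])
    \<comment> \<open>\<open>\<phi>\<close> exchanges the two sides of the inequation that defines \<open>mixed\<close>.\<close>
    have "mixed (\<phi> S) \<longleftrightarrow> mixed S" unfolding mixed_def oddY[OF S] W by argo
    then have "D (\<phi> S) = D S" by (simp add: D_def)
    then show "\<phi> (\<phi> S) = S" by (auto simp: \<phi>_def)
    show "even (card (\<phi> S)) \<longleftrightarrow> odd (card S)"
      using toggle[OF S, of UNIV] D_odd[of S] unfolding Int_UNIV_right by argo
    show "graph_nullity (?G \<restriction> \<phi> S) = graph_nullity (?G \<restriction> S)"
    proof (rule graph_nullity_eqI)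
      show "finite (verts (?G \<restriction> \<phi> S))" "finite (verts (?G \<restriction> S))"
        using S closed[OF S] fin by (auto intro: rev_finite_subset)
      show "card (even_neighbour_sets (?G \<restriction> \<phi> S)) = card (even_neighbour_sets (?G \<restriction> S))"
        using S closed[OF S] card_even_neighbour_sets_Gab[of S a b]
          card_even_neighbour_sets_Gab[of "\<phi> S" a b]
        by (simp only: with_proj_simps(1) oddX[OF S] oddY[OF S] U V W card_cycle_kernel_pivot)
    qed
  qed (rule fin)
  moreover have "2 \<le> card (verts ?G)"
    using card_mono[OF fin, of "{VU, VV}"] mem by simp
  ultimately show ?thesis
    using connected_Gab reducible_interlace_polyI[OF fin] by blast
qed

end
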